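(* Let $R$ be a unital commutative ring in which $6$ is invertible and let $n\geq 3$. Then for every $s\in\{1,2,\dots,n\}$ the matrix unit $e_{ss}$ is a Jordan product determined point in $M_n(R)$.
   Context: $M_n(R)$ is the algebra of all $n\times n$ matrices over $R$; $e_{ij}$ denotes the matrix unit with $1$ in position $(i,j)$ and $0$ elsewhere. The Jordan product is $x\circ y=xy+yx$. $M_n(R)^2$ denotes the $R$-linear span of all elements of the form $xy$ with $x,y\in M_n(R)$. An $R$-bilinear map $\{\cdot,\cdot\}:M_n(R)\times M_n(R)\to X$ is symmetric if $\{x,y\}=\{y,x\}$ for all $x,y$. A matrix $A\in M_n(R)$ is called a Jordan product determined point (in $M_n(R)$) if for every $R$-module $X$ and every symmetric $R$-bilinear map $\{\cdot,\cdot\}:M_n(R)\times M_n(R)\to X$ the following two conditions are equivalent: (i) there exists a fixed element $w\in X$ such that $\{x,y\}=w$ whenever $x,y\in M_n(R)$ satisfy $x\circ y=A$; (ii) there exists an $R$-linear map $T:M_n(R)^2\to X$ such that $\{x,y\}=T(x\circ y)$ for all $x,y\in M_n(R)$. *)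

theory Defs
  imports "HOL-Analysis.Analysis"
begin

definition matrix_scale :: "'r::comm_ring_1 \<Rightarrow> 'r^'n^'n \<Rightarrow> 'r^'n^'n"
  where "matrix_scale c A = (\<chi> i j. c * A $ i $ j)"

global_interpretation matrix_module: module matrix_scale
  by unfold_locales (simp_all add: matrix_scale_def vec_eq_iff algebra_simps)

definition matrix_unit :: "'n \<Rightarrow> 'n \<Rightarrow> 'r::comm_ring_1^'n^'n"
  where "matrix_unit i j = (\<chi> k l. if k = i \<and> l = j then 1 else 0)"

definition jordan_product :: "'r::comm_ring_1^'n^'n \<Rightarrow> 'r^'n^'n \<Rightarrow> 'r^'n^'n"  (infixl "\<circ>\<^sub>J" 70)
  where "x \<circ>\<^sub>J y = x ** y + y ** x"

definition matrix_square :: "('r::comm_ring_1^'n^'n) set"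
  where "matrix_square = matrix_module.span {x ** y |(x :: 'r^'n^'n) (y :: 'r^'n^'n). True}"

(* An R-module is a type 'x together with a scalar multiplication smul such that "module smul". *)
definition symmetric_bilinear ::
    "('r::comm_ring_1 \<Rightarrow> 'x::ab_group_add \<Rightarrow> 'x) \<Rightarrow> ('r^'n^'n \<Rightarrow> 'r^'n^'n \<Rightarrow> 'x) \<Rightarrow> bool"
  where "symmetric_bilinear smul B \<longleftrightarrow>
    (\<forall>x. module_hom matrix_scale smul (\<lambda>y. B x y)) \<and>
    (\<forall>y. module_hom matrix_scale smul (\<lambda>x. B x y)) \<and>
    (\<forall>x y. B x y = B y x)"

(* T is a total HOL function, but only its restriction to the submodule S is constrained. *)
definition linear_on_submodule ::
    "('r::comm_ring_1^'n^'n) set \<Rightarrow> ('r \<Rightarrow> 'x::ab_group_add \<Rightarrow> 'x) \<Rightarrow> ('r^'n^'n \<Rightarrow> 'x) \<Rightarrow> bool"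
  where "linear_on_submodule S smul T \<longleftrightarrow>
    (\<forall>a\<in>S. \<forall>b\<in>S. T (a + b) = T a + T b) \<and>
    (\<forall>c. \<forall>a\<in>S. T (matrix_scale c a) = smul c (T a))"

(* HOL cannot quantify over types inside a formula, so the carrier type of the test module X is a
   type parameter; all module structures on it are quantified over.  A theorem in which
   'x is a type variable asserts the property for every module X. *)
definition jordan_product_determined_point ::
    "'x::ab_group_add itself \<Rightarrow> 'r::comm_ring_1^'n^'n \<Rightarrow> bool"
  where "jordan_product_determined_point TYPE('x) A \<longleftrightarrow>
    (\<forall>(smul :: 'r \<Rightarrow> 'x \<Rightarrow> 'x) (B :: 'r^'n^'n \<Rightarrow> 'r^'n^'n \<Rightarrow> 'x).
      module smul \<longrightarrow> symmetric_bilinear smul B \<longrightarrow>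
        ((\<exists>w. \<forall>x y. x \<circ>\<^sub>J y = A \<longrightarrow> B x y = w) \<longleftrightarrow>
         (\<exists>T. linear_on_submodule matrix_square smul T \<and> (\<forall>x y. B x y = T (x \<circ>\<^sub>J y)))))"

end

theory Submission
  imports Defs
begin

text \<open>
  Put \<open>e = e\<^sub>s\<^sub>s\<close> and subtract \<open>B (x \<circ> y, 1/2)\<close> from the given form \<open>B\<close>. The new form vanishes on
  \<open>(x, 1)\<close>, hence on \<open>(e, 1/2)\<close>, so its constant value on the pairs with \<open>x \<circ> y = e\<close> is \<open>0\<close>.
  Evaluating it on suitable pairs with \<open>x \<circ> y = c e\<close>, \<open>c\<close> a unit, shows that it vanishes on all
  pairs of matrix units, one pair of Peirce components with respect to \<open>e\<close> at a time. Therefore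
  \<open>B (x, y) = B (x \<circ> y, 1/2)\<close>.
\<close>

section \<open>Algebra of matrix units, scaling and transposition\<close>

lemma matrix_unit_mult:
  "matrix_unit i j ** (matrix_unit k l :: 'r::comm_ring_1^'n::finite^'n) =
    (if j = k then matrix_unit i l else 0)"
proof -
  have "(\<Sum>m\<in>UNIV. matrix_unit i j $ a $ m * matrix_unit k l $ m $ b) =
      ((if j = k then matrix_unit i l else 0) $ a $ b :: 'r)" for a b
  proof -
    have "matrix_unit i j $ a $ m * matrix_unit k l $ m $ b =
        (if m = j then (if j = k then matrix_unit i l else 0) $ a $ b else (0::'r))" for m
      by (simp add: matrix_unit_def)
    then show ?thesis by simp
  qed
  then show ?thesis
    by (simp add: matrix_matrix_mult_def vec_eq_iff)
qed

lemma matrix_scale_mult_left: "matrix_scale c x ** y = matrix_scale c (x ** y)"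
  by (simp add: matrix_scale_def matrix_matrix_mult_def vec_eq_iff sum_distrib_left mult.assoc)

lemma matrix_scale_mult_right: "x ** matrix_scale c y = matrix_scale c (x ** y)"
  by (simp add: matrix_scale_def matrix_matrix_mult_def vec_eq_iff sum_distrib_left mult.left_commute)

lemma transpose_matrix_unit: "transpose (matrix_unit i j) = matrix_unit j i"
  by (auto simp: transpose_def matrix_unit_def vec_eq_iff)

lemma transpose_matrix_scale: "transpose (matrix_scale c x) = matrix_scale c (transpose x)"
  by (simp add: transpose_def matrix_scale_def vec_eq_iff)

lemma transpose_add: "transpose (x + y) = transpose x + transpose y"
  by (simp add: transpose_def vec_eq_iff)

lemma matrix_mult_add_left: "(x + y) ** z = x ** z + y ** (z :: 'r::comm_ring_1^'n^'n)"
  by (simp add: matrix_matrix_mult_def vec_eq_iff distrib_right sum.distrib)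

lemma matrix_mult_diff_left: "(x - y) ** z = x ** z - y ** (z :: 'r::comm_ring_1^'n^'n)"
  by (simp add: matrix_matrix_mult_def vec_eq_iff left_diff_distrib sum_subtractf)

lemma matrix_mult_diff_right: "z ** (x - y) = z ** x - z ** (y :: 'r::comm_ring_1^'n^'n)"
  by (simp add: matrix_matrix_mult_def vec_eq_iff right_diff_distrib sum_subtractf)

lemmas matrix_expand =
  matrix_add_ldistrib matrix_mult_add_left matrix_mult_diff_left matrix_mult_diff_right
  matrix_scale_mult_left matrix_scale_mult_right

lemma matrix_unit_expansion:
  "(\<Sum>i\<in>UNIV. \<Sum>j\<in>UNIV. matrix_scale (x $ i $ j) (matrix_unit i j)) = (x :: 'r::comm_ring_1^'n::finite^'n)"
proof -
  have "(\<Sum>i\<in>UNIV. \<Sum>j\<in>UNIV. if k = i \<and> l = j then x $ i $ j else 0) = x $ k $ l" for k l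
  proof -
    have "(\<Sum>j\<in>UNIV. if k = i \<and> l = j then x $ i $ j else 0) = (if i = k then x $ k $ l else 0)" for i
      by (cases "i = k") auto
    then show ?thesis by simp
  qed
  then show ?thesis
    by (simp add: vec_eq_iff matrix_scale_def matrix_unit_def if_distrib[of "(*) _"] cong: if_cong)
qed

lemma sum_matrix_unit_diagonal: "(\<Sum>k\<in>UNIV. matrix_unit k k) = (mat 1 :: 'r::comm_ring_1^'n::finite^'n)"
proof -
  have "(\<Sum>k\<in>UNIV. if a = k \<and> b = k then 1 else (0::'r)) = (if a = b then 1 else 0)" for a b :: 'n
    by (cases "a = b") (auto intro!: sum.neutral)
  then show ?thesis
    by (simp add: vec_eq_iff matrix_unit_def mat_def)
qed

section \<open>Normalized forms and cancellation of invertible scalars\<close>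

locale normalized_form = module smul
  for smul :: "'r::comm_ring_1 \<Rightarrow> 'x::ab_group_add \<Rightarrow> 'x" +
  fixes B :: "'r^'n::finite^'n \<Rightarrow> 'r^'n^'n \<Rightarrow> 'x" and s :: 'n
  assumes form: "symmetric_bilinear smul B"
    and form_one: "B x (mat 1) = 0"
    and form_unit: "x \<circ>\<^sub>J y = matrix_unit s s \<Longrightarrow> B x y = 0"
    and six: "(6::'r) dvd 1"
begin

abbreviation E :: "'n \<Rightarrow> 'n \<Rightarrow> 'r^'n^'n"
  where "E \<equiv> matrix_unit"

abbreviation e :: "'r^'n^'n"
  where "e \<equiv> matrix_unit s s"

lemma hom_right: "module_hom matrix_scale smul (B x)"
  and hom_left: "module_hom matrix_scale smul (\<lambda>x. B x y)"
  using form by (simp_all add: symmetric_bilinear_def)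

lemma form_commute: "B x y = B y x"
  using form by (simp add: symmetric_bilinear_def)

lemmas form_expand =
  module_hom.add[OF hom_right] module_hom.add[OF hom_left]
  module_hom.diff[OF hom_right] module_hom.diff[OF hom_left]
  module_hom.scale[OF hom_right] module_hom.scale[OF hom_left]

lemma form_zero [simp]: "B x 0 = 0" "B 0 x = 0"
  by (rule module_hom.zero[OF hom_right], rule module_hom.zero[OF hom_left])

lemma scale_unit_cancel: "c dvd 1 \<Longrightarrow> smul c a = 0 \<Longrightarrow> a = 0"
proof (elim dvdE)
  fix d assume "smul c a = 0" "1 = c * d"
  then show "a = 0" by (metis mult.commute scale_one scale_scale scale_zero_right)
qed

lemma two: "(2::'r) dvd 1" and twelve: "(12::'r) dvd 1"
proof -
  have "(2::'r) dvd 2 * 3" by (rule dvd_triv_left)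
  then show two: "(2::'r) dvd 1"
    using dvd_trans[OF _ six, of 2] by simp
  show "(12::'r) dvd 1"
    using mult_dvd_mono[OF two six] by simp
qed

lemma double_eq_zero: "a + a = 0 \<Longrightarrow> (a::'x) = 0"
  using scale_unit_cancel[OF two, of a] scale_left_distrib[of 1 1 a] by simp

lemma neg_eq_self: "- a = a \<Longrightarrow> (a::'x) = 0"
  by (metis add.right_inverse double_eq_zero)

text \<open>Scaling one argument by the inverse of \<open>c\<close> turns the Jordan product into
  \<open>e\<close>, and a unit factor in front of a value of \<open>B\<close> can be cancelled. Test
  pairs may thus have integer coefficients.\<close>

lemma form_eq_zero:
  assumes "c dvd 1" "x \<circ>\<^sub>J y = matrix_scale c e"
  shows "B x y = 0"
proof -
  obtain d where d: "1 = c * d" using assms(1) by (elim dvdE)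
  have "matrix_scale d x \<circ>\<^sub>J y = matrix_scale d (x \<circ>\<^sub>J y)"
    by (simp add: jordan_product_def matrix_expand matrix_module.scale_right_distrib)
  also have "\<dots> = e"
    using d by (simp add: assms(2) mult.commute)
  finally have "smul d (B x y) = 0"
    using form_unit[of "matrix_scale d x" y] by (simp add: form_expand)
  moreover have "d dvd 1" using d by (metis dvd_triv_right)
  ultimately show ?thesis by (rule scale_unit_cancel[rotated])
qed

lemma form_eq_zero_double: "x \<circ>\<^sub>J y = e + e \<Longrightarrow> B x y = 0"
  using form_eq_zero[OF two, of x y] matrix_module.scale_left_distrib[of 1 1 e] by simp

section \<open>The Peirce corner \<open>(1 - e) M (1 - e)\<close>\<close>

definition corner :: "'r^'n^'n \<Rightarrow> bool"
  where "corner u \<longleftrightarrow> e ** u = 0 \<and> u ** e = 0"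

text \<open>As \<open>e\<close> annihilates \<open>u\<close> and \<open>v\<close> on both sides,
  \<open>e + u\<close> and \<open>e + v\<close> have Jordan product \<open>2 e\<close>. Setting
  \<open>u\<close>, \<open>v\<close> or both to zero later isolates the four summands.\<close>

lemma form_corner_aux:
  assumes "corner u" "corner v" "u \<circ>\<^sub>J v = 0"
  shows "B e e + B e v + B u e + B u v = 0"
proof -
  have "(e + u) \<circ>\<^sub>J (e + v) = e + e"
    using assms by (simp add: corner_def jordan_product_def matrix_expand matrix_unit_mult add_ac)
  then have "B (e + u) (e + v) = 0" by (rule form_eq_zero_double)
  then show ?thesis by (simp add: form_expand add_ac)
qed

lemma corner_zero: "corner 0"
  by (simp add: corner_def)

lemma form_e_e: "B e e = 0"
  using form_corner_aux[OF corner_zero corner_zero] by (simp add: jordan_product_def)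

lemma form_e_corner: "corner v \<Longrightarrow> B e v = 0"
  using form_corner_aux[OF corner_zero, of v] form_e_e by (simp add: jordan_product_def)

lemma form_corner: "corner u \<Longrightarrow> corner v \<Longrightarrow> u \<circ>\<^sub>J v = 0 \<Longrightarrow> B u v = 0"
  using form_corner_aux[of u v] form_e_e form_e_corner[of u] form_e_corner[of v]
  by (simp add: form_commute)

section \<open>The Peirce column \<open>(1 - e) M e\<close>\<close>

definition peirce_column :: "'r^'n^'n \<Rightarrow> bool"
  where "peirce_column q \<longleftrightarrow> e ** q = 0 \<and> q ** e = q"

lemma column_corner_mult:
  assumes "peirce_column q" "corner v"
  shows "peirce_column (v ** q)" "q ** v = 0"
proof -
  have q: "e ** q = 0" "q ** e = q" and v: "e ** v = 0"
    using assms by (simp_all add: peirce_column_def corner_def)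
  have "(v ** q) ** e = v ** (q ** e)" "e ** (v ** q) = (e ** v) ** q"
    by (simp_all only: matrix_mul_assoc)
  then show "peirce_column (v ** q)"
    by (simp add: peirce_column_def q v)
  have "(q ** e) ** v = q ** (e ** v)"
    by (simp only: matrix_mul_assoc)
  then show "q ** v = 0"
    by (simp add: q v)
qed

lemma column_column_mult:
  assumes "peirce_column q" "peirce_column q'"
  shows "q ** q' = 0"
proof -
  have "q ** q' = (q ** e) ** q'" using assms(1) by (simp only: peirce_column_def)
  also have "\<dots> = q ** (e ** q')" by (simp only: matrix_mul_assoc)
  finally show ?thesis using assms(2) by (simp add: peirce_column_def)
qed

lemma form_column_aux:
  assumes "peirce_column q" "corner v"
  shows "B q v - B q q - B q (v ** q) = B e (v ** q)"
proof -
  note mult = column_corner_mult[OF assms]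
  note mult = mult column_column_mult[OF assms(1) assms(1)]
    column_column_mult[OF assms(1) mult(1)] column_column_mult[OF mult(1) assms(1)]
  \<comment> \<open>In the second factor, \<open>- q\<close> cancels the term \<open>q ** e\<close>
    and \<open>- v ** q\<close> cancels the term \<open>v ** q\<close>; all other mixed products are
    zero.\<close>
  have "(e + q) \<circ>\<^sub>J (e + v - q - v ** q) = e + e"
    using assms mult by (simp add: corner_def peirce_column_def jordan_product_def matrix_expand
        matrix_unit_mult algebra_simps)
  then have "B (e + q) (e + v - q - v ** q) = 0" by (rule form_eq_zero_double)
  then show ?thesis
    using form_e_e form_e_corner[OF assms(2)] form_commute[of e q]
    by (simp add: form_expand algebra_simps)
qed

lemma form_column_self: "peirce_column q \<Longrightarrow> B q q = 0"
  using form_column_aux[OF _ corner_zero, of q] by simp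

text \<open>Polarization of \<open>form_column_self\<close>, followed by cancelling 2.\<close>

lemma form_column_column:
  assumes "peirce_column q" "peirce_column q'"
  shows "B q q' = 0"
proof -
  have "peirce_column (q + q')" using assms by (simp add: peirce_column_def matrix_expand)
  then have "B (q + q') (q + q') = 0" by (rule form_column_self)
  then show ?thesis
    using assms form_commute[of q' q]
    by - (rule double_eq_zero, simp add: form_expand form_column_self)
qed

lemma form_column_corner:
  assumes "peirce_column q" "corner v"
  shows "B q v = B e (v ** q)"
proof -
  have "peirce_column (v ** q)"
    using assms by (rule column_corner_mult)
  then show ?thesis
    using form_column_aux[OF assms] form_column_column[of q] assms by simp
qed

text \<open>The corner element \<open>mat 1 - e\<close> fixes \<open>q\<close> from the left, so
  \<open>form_column_corner\<close> gives \<open>B q (mat 1 - e) = B e q\<close>. The normalization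
  \<open>form_one\<close> makes the same value \<open>- B e q\<close>.\<close>

lemma form_e_column:
  assumes "peirce_column q"
  shows "B e q = 0"
proof -
  have "corner (mat 1 - e)"
    by (simp add: corner_def matrix_expand matrix_unit_mult)
  then have "B q (mat 1 - e) = B e ((mat 1 - e) ** q)"
    using assms by (rule form_column_corner[rotated])
  then have "- B e q = B e q"
    using assms form_commute[of q e]
    by (simp add: form_expand form_one peirce_column_def matrix_expand)
  then show ?thesis by (rule neg_eq_self)
qed

lemma form_column_corner_zero:
  assumes "peirce_column q" "corner v"
  shows "B q v = 0"
proof -
  have "peirce_column (v ** q)"
    using assms by (rule column_corner_mult)
  then show ?thesis
    by (simp add: form_column_corner[OF assms] form_e_column)
qed

section \<open>Pairs of matrix units in the corner\<close>

lemma corner_unit: "i \<noteq> s \<Longrightarrow> j \<noteq> s \<Longrightarrow> corner (E i j)"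
  by (simp add: corner_def matrix_unit_mult)

lemma corner_add: "corner u \<Longrightarrow> corner v \<Longrightarrow> corner (u + v)"
  and corner_diff: "corner u \<Longrightarrow> corner v \<Longrightarrow> corner (u - v)"
  by (simp_all add: corner_def matrix_expand)

lemmas corner_intros = corner_unit corner_add corner_diff

lemma column_unit: "i \<noteq> s \<Longrightarrow> peirce_column (E i s)"
  by (simp add: peirce_column_def matrix_unit_mult)

lemma form_units_disjoint:
  assumes "i \<noteq> s" "j \<noteq> s" "k \<noteq> s" "l \<noteq> s" "j \<noteq> k" "i \<noteq> l"
  shows "B (E i j) (E k l) = 0"
  using assms by (intro form_corner) (simp_all add: corner_unit jordan_product_def matrix_unit_mult)

lemma form_sum_diagonal: "(\<Sum>k\<in>UNIV. B x (E k k)) = 0"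
  by (metis form_one module_hom.sum[OF hom_right] sum_matrix_unit_diagonal)

text \<open>Expand \<open>mat 1\<close> along the diagonal in \<open>B (E i i) (mat 1) = 0\<close>:
  the term at \<open>s\<close> pairs \<open>e\<close> with a corner element, and the other terms
  with \<open>k \<noteq> i\<close> pair orthogonal idempotents.\<close>

lemma form_diagonal:
  assumes "i \<noteq> s" shows "B (E i i) (E i i) = 0"
proof -
  have "B (E i i) (E k k) = (if k = i then B (E i i) (E i i) else 0)" for k
    using assms form_units_disjoint[of i i k k] form_commute[of "E i i" e]
    by (cases "k = s") (auto simp: form_e_corner corner_unit)
  then have "(\<Sum>k\<in>UNIV. B (E i i) (E k k)) = (\<Sum>k\<in>UNIV. if k = i then B (E i i) (E i i) else 0)"
    by (rule sum.cong[OF refl])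
  then show ?thesis
    by (simp add: form_sum_diagonal)
qed

text \<open>A corner pair with zero Jordan product shows that the two values agree; expanding
  \<open>B (E i j) (mat 1) = 0\<close> shows that they sum to zero. Since 2 is invertible, both
  vanish.\<close>

lemma form_diagonal_unit:
  assumes "i \<noteq> s" "j \<noteq> s" "i \<noteq> j"
  shows "B (E i j) (E i i) = 0" "B (E i j) (E j j) = 0"
proof -
  have "B (E i i + E i j) (E j j - E i j) = 0"
    using assms
    by (intro form_corner corner_intros) (simp_all add: jordan_product_def matrix_expand matrix_unit_mult)
  then have eq: "B (E i j) (E i i) = B (E i j) (E j j)"
    using assms form_commute[of "E i i" "E i j"]
    by (simp add: form_expand form_units_disjoint)
  have "B (E i j) (E k k) = (if k = i then B (E i j) (E i i) else 0) + (if k = j then B (E i j) (E j j) else 0)" for k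
    using assms form_units_disjoint[of i j k k] form_commute[of "E i j" e]
    by (cases "k = s") (auto simp: form_e_corner corner_unit)
  then have "(\<Sum>k\<in>UNIV. B (E i j) (E k k)) = (\<Sum>k\<in>UNIV.
      (if k = i then B (E i j) (E i i) else 0) + (if k = j then B (E i j) (E j j) else 0))"
    by (rule sum.cong[OF refl])
  then have "B (E i j) (E i i) + B (E i j) (E j j) = 0"
    by (simp add: form_sum_diagonal sum.distrib)
  then show "B (E i j) (E i i) = 0"
    unfolding eq by (rule double_eq_zero)
  then show "B (E i j) (E j j) = 0"
    by (simp add: eq)
qed

lemma form_chain:
  assumes "i \<noteq> s" "j \<noteq> s" "l \<noteq> s" "i \<noteq> j" "j \<noteq> l" "i \<noteq> l"
  shows "B (E i j) (E j l) = 0"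
proof -
  \<comment> \<open>The extra units make \<open>E i l ** E l l\<close> cancel the product
    \<open>E i j ** E j l = E i l\<close>.\<close>
  have "B (E i j + E i l) (E j l - E l l) = 0"
    using assms
    by (intro form_corner corner_intros) (simp_all add: jordan_product_def matrix_expand matrix_unit_mult)
  then show ?thesis
    using assms by (simp add: form_expand form_units_disjoint form_diagonal_unit)
qed

lemma form_opposite:
  assumes "i \<noteq> s" "j \<noteq> s" "i \<noteq> j"
  shows "B (E i j) (E j i) = 0"
proof -
  \<comment> \<open>On the indices \<open>i\<close>, \<open>j\<close> these are the blocks
    \<open>(1, 1; 1, 1)\<close> and \<open>(1, -1; -1, 1)\<close>, whose products in both orders are
    zero.\<close>
  have "B (E i i + E i j + E j i + E j j) (E i i - E i j - E j i + E j j) = 0"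
    using assms
    by (intro form_corner corner_intros) (simp_all add: jordan_product_def matrix_expand matrix_unit_mult)
  then have "- B (E i j) (E j i) = B (E i j) (E j i)"
    using assms form_commute[of "E j i" "E i j"] form_commute[of "E i i" "E i j"]
      form_commute[of "E i i" "E j i"] form_commute[of "E j j" "E i j"] form_commute[of "E j j" "E j i"]
    by (simp add: form_expand form_units_disjoint form_diagonal_unit form_diagonal)
  then show ?thesis by (rule neg_eq_self)
qed

text \<open>Besides proper chains this covers those with one diagonal factor;
  \<open>i \<noteq> l\<close> excludes two.\<close>

lemma form_composable:
  assumes "i \<noteq> s" "j \<noteq> s" "l \<noteq> s" "i \<noteq> l"
  shows "B (E i j) (E j l) = 0"
  using assms form_chain[of i j l] form_diagonal_unit[of i l] form_commute[of "E i i" "E i l"]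
  by (cases "i = j"; cases "j = l") auto

text \<open>The cases record which of the products \<open>E i j ** E k l\<close> and
  \<open>E k l ** E i j\<close> are nonzero.\<close>

lemma form_corner_units:
  assumes "i \<noteq> s" "j \<noteq> s" "k \<noteq> s" "l \<noteq> s"
  shows "B (E i j) (E k l) = 0"
proof (cases "j = k"; cases "i = l")
  assume "j = k" "i = l"
  then show ?thesis
    using assms form_diagonal[of i] form_opposite[of i j] by (cases "i = j") auto
next
  assume "j = k" "i \<noteq> l"
  then show ?thesis using assms by (simp add: form_composable)
next
  assume "j \<noteq> k" "i = l"
  then show ?thesis
    using assms form_composable[of k i j] form_commute[of "E i j" "E k i"] by simp
next
  assume "j \<noteq> k" "i \<noteq> l"
  then show ?thesis using assms by (simp add: form_units_disjoint)
qed

section \<open>The Peirce row \<open>e M (1 - e)\<close>, by transposition\<close>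

lemma transposed_form: "normalized_form smul (\<lambda>x y. B (transpose x) (transpose y)) s"
proof
  have "module_hom matrix_scale matrix_scale (transpose :: 'r^'n^'n \<Rightarrow> _)"
    by unfold_locales (simp_all add: transpose_add transpose_matrix_scale)
  then show "symmetric_bilinear smul (\<lambda>x y. B (transpose x) (transpose y))"
    using module_hom_compose[OF _ hom_right] module_hom_compose[OF _ hom_left] form_commute
    by (auto simp: symmetric_bilinear_def o_def)
  show "B (transpose x) (transpose (mat 1)) = 0" for x
    by (simp add: form_one)
  show "B (transpose x) (transpose y) = 0" if "x \<circ>\<^sub>J y = e" for x y
  proof (rule form_unit)
    \<comment> \<open>Transposition reverses products, but the Jordan product is symmetric, so it is
      preserved; \<open>e\<close> is its own transpose.\<close>
    have "transpose x \<circ>\<^sub>J transpose y = transpose (x \<circ>\<^sub>J y)"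
      by (simp add: jordan_product_def matrix_transpose_mul transpose_add add.commute)
    then show "transpose x \<circ>\<^sub>J transpose y = e"
      by (simp add: that transpose_matrix_unit)
  qed
qed (rule six)

text \<open>Transposition exchanges columns with rows and preserves the corner, so each column
  result for the transposed form is a row result for \<open>B\<close>.\<close>

interpretation transposed: normalized_form smul "\<lambda>x y. B (transpose x) (transpose y)" s
  by (rule transposed_form)

lemma form_row_row: "i \<noteq> s \<Longrightarrow> j \<noteq> s \<Longrightarrow> B (E s i) (E s j) = 0"
  using transposed.form_column_column[OF transposed.column_unit transposed.column_unit, of i j]
  by (simp add: transpose_matrix_unit)

lemma form_row_corner: "i \<noteq> s \<Longrightarrow> j \<noteq> s \<Longrightarrow> k \<noteq> s \<Longrightarrow> B (E s i) (E j k) = 0"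
  using transposed.form_column_corner_zero[OF transposed.column_unit transposed.corner_unit, of i k j]
  by (simp add: transpose_matrix_unit)

lemma form_e_row: "i \<noteq> s \<Longrightarrow> B e (E s i) = 0"
  using transposed.form_e_column[OF transposed.column_unit, of i]
  by (simp add: transpose_matrix_unit)

lemmas form_units =
  form_e_e form_e_corner[OF corner_unit] form_e_column[OF column_unit] form_e_row
  form_column_column[OF column_unit column_unit] form_row_row
  form_column_corner_zero[OF column_unit corner_unit] form_row_corner form_corner_units

lemmas form_units_all = form_units form_units[THEN trans[OF form_commute]]

section \<open>Pairs of a row unit and a column unit\<close>

lemma form_row_column_distinct:
  assumes "i \<noteq> s" "j \<noteq> s" "i \<noteq> j"
  shows "B (E s j) (E i s) = 0"
proof -
  \<comment> \<open>Here \<open>- E j j\<close> cancels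
    \<open>e \<circ>\<^sub>J E s j = E s j\<close>, \<open>- E i i\<close> cancels
    \<open>e \<circ>\<^sub>J E i s = E i s\<close>, and \<open>E i j\<close> paired with
    \<open>- E j j\<close> cancels \<open>E s j \<circ>\<^sub>J E i s = E i j\<close>. Only
    \<open>2 e\<close> remains.\<close>
  have "B (e + E s j - E i i + E i j) (e + E i s - E j j) = 0"
    using assms
    by (intro form_eq_zero_double) (simp add: jordan_product_def matrix_expand matrix_unit_mult)
  then show ?thesis
    using assms by (simp add: form_expand form_units_all)
qed

lemma form_row_column_same:
  assumes "i \<noteq> s"
  shows "B (E s i) (E i s) = 0"
proof -
  \<comment> \<open>In the \<open>(s, i)\<close>-block \<open>?x\<close> is \<open>(0, -2; 1, 3)\<close>, with eigenvalues \<open>1\<close> and \<open>2\<close>, and \<open>?y\<close> is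
    the unique solution of \<open>?x \<circ> ?y = 12 e\<close>; the denominator \<open>12\<close> comes from the sums
    \<open>2\<close>, \<open>3\<close>, \<open>4\<close> of eigenvalues.\<close>
  let ?x = "E i s - matrix_scale 2 (E s i) + matrix_scale 3 (E i i)"
  let ?y = "matrix_scale 11 e + matrix_scale 6 (E s i) - matrix_scale 3 (E i s) - matrix_scale 2 (E i i)"
  have "?x \<circ>\<^sub>J ?y = matrix_scale 12 e"
    using assms
    by (simp add: jordan_product_def matrix_expand matrix_unit_mult matrix_module.scale_right_distrib
        matrix_module.scale_right_diff_distrib)
      (simp add: matrix_scale_def vec_eq_iff)
  then have "B ?x ?y = 0" by (rule form_eq_zero[OF twelve])
  \<comment> \<open>Only row-column pairs survive, with coefficients \<open>1 * 6\<close> and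
    \<open>(-2) * (-3)\<close>.\<close>
  then have "smul 6 (B (E s i) (E i s)) + smul 6 (B (E s i) (E i s)) = 0"
    using assms form_commute[of "E i s" "E s i"]
    by (simp add: form_expand form_units_all)
  then show ?thesis
    by (rule scale_unit_cancel[OF six double_eq_zero])
qed

lemma form_row_column: "i \<noteq> s \<Longrightarrow> j \<noteq> s \<Longrightarrow> B (E s j) (E i s) = 0"
  using form_row_column_distinct form_row_column_same by metis

section \<open>Vanishing of the normalized form on all pairs\<close>

lemma form_matrix_units: "B (E i j) (E k l) = 0"
  \<comment> \<open>Comparing each index with \<open>s\<close> places both units in Peirce
    components.\<close>
  by (cases "i = s"; cases "j = s"; cases "k = s"; cases "l = s")
    (simp_all add: form_row_column form_row_column[THEN trans[OF form_commute]] form_units_all)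

lemma form_vanishes: "B x y = 0"
proof -
  have unit: "B (E i j) y = 0" for i j y
    by (subst matrix_unit_expansion[of y, symmetric])
      (simp add: module_hom.sum[OF hom_right] form_expand form_matrix_units)
  show ?thesis
    by (subst matrix_unit_expansion[of x, symmetric])
      (simp add: module_hom.sum[OF hom_left] form_expand unit)
qed

end

section \<open>Reduction of an arbitrary form to a normalized one\<close>

lemma jordan_product_half:
  assumes "2 * h = (1::'r::comm_ring_1)"
  shows "x \<circ>\<^sub>J matrix_scale h (mat 1) = (x :: 'r^'n::finite^'n)"
proof -
  have "x \<circ>\<^sub>J matrix_scale h (mat 1) = matrix_scale h x + matrix_scale h x"
    by (simp add: jordan_product_def matrix_expand)
  also have "\<dots> = matrix_scale (2 * h) x"
    by (simp only: mult_2 matrix_module.scale_left_distrib)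
  finally show ?thesis
    by (simp add: assms)
qed

theorem theorem2p2:
  fixes s :: "'n::finite"
  assumes "(6 :: 'r::comm_ring_1) dvd 1"
    and "CARD('n) \<ge> 3"
  shows "jordan_product_determined_point TYPE('x::ab_group_add) (matrix_unit s s :: 'r^'n^'n)"
  unfolding jordan_product_determined_point_def
proof (intro allI impI iffI)
  fix smul :: "'r \<Rightarrow> 'x \<Rightarrow> 'x" and B :: "'r^'n^'n \<Rightarrow> 'r^'n^'n \<Rightarrow> 'x"
  assume "module smul" and B: "symmetric_bilinear smul B"
    and "\<exists>w. \<forall>x y. x \<circ>\<^sub>J y = matrix_unit s s \<longrightarrow> B x y = w"
  then obtain w where w: "\<And>x y. x \<circ>\<^sub>J y = matrix_unit s s \<Longrightarrow> B x y = w" by blast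
  interpret module smul by fact
  obtain t where t: "1 = 6 * (t::'r)" using assms(1) by (elim dvdE)
  define h where "h = 3 * t"
  have h: "2 * h = 1" using t by (simp add: h_def)
  \<comment> \<open>This choice is forced: every \<open>z\<close> is its own Jordan product with
    \<open>matrix_scale h (mat 1)\<close>, \<open>h\<close> being the inverse of 2.\<close>
  define T where "T z = B z (matrix_scale h (mat 1))" for z
  have hom_left: "module_hom matrix_scale smul (\<lambda>x. B x y)"
    and hom_right: "module_hom matrix_scale smul (B y)" for y
    using B by (simp_all add: symmetric_bilinear_def)
  have homT: "module_hom matrix_scale smul T"
    unfolding T_def by (rule hom_left)
  define D where "D x y = B x y - T (x \<circ>\<^sub>J y)" for x y
  have D_commute: "D x y = D y x" for x y
    using B by (simp add: D_def symmetric_bilinear_def jordan_product_def add.commute)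
  have homJ: "module_hom matrix_scale matrix_scale (\<lambda>y. x \<circ>\<^sub>J y)" for x :: "'r^'n^'n"
    by unfold_locales
      (simp_all add: jordan_product_def matrix_expand matrix_module.scale_right_distrib)
  have homD: "module_hom matrix_scale smul (D x)" for x
    unfolding D_def
    using module_pair.module_hom_sub[OF module_pair.intro[OF matrix_module.module_axioms module_axioms]
       hom_right module_hom_compose[OF homJ homT], of x x]
    by (simp add: o_def)
  interpret D: normalized_form smul D s
  proof
    have "(\<lambda>x. D x y) = D y" for y using D_commute by blast
    then show "symmetric_bilinear smul D"
      using homD D_commute by (auto simp: symmetric_bilinear_def)
    show "D x (mat 1) = 0" for x
    proof -
      \<comment> \<open>Write 1 as \<open>2 * h\<close>, then move the 2 into the first argument and
        \<open>h\<close> into the second.\<close>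
      have "B x (mat 1) = smul (2 * h) (B x (mat 1))" by (simp add: h)
      also have "\<dots> = T (matrix_scale 2 x)"
        unfolding T_def
        by (simp add: module_hom.scale[OF hom_left] module_hom.scale[OF hom_right] mult.commute)
      also have "matrix_scale 2 x = x \<circ>\<^sub>J mat 1"
        using matrix_module.scale_left_distrib[of 1 1 x] by (simp add: jordan_product_def)
      finally show ?thesis by (simp add: D_def)
    qed
    show "D x y = 0" if "x \<circ>\<^sub>J y = matrix_unit s s" for x y
      \<comment> \<open>The pair of \<open>matrix_unit s s\<close> and
        \<open>matrix_scale h (mat 1)\<close> is itself admissible, so
        \<open>T (matrix_unit s s) = w\<close> and the two constants cancel.\<close>
      using w[OF that] w[OF jordan_product_half[OF h]] by (simp add: D_def T_def that)
  qed (rule assms(1))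
  have "B x y = T (x \<circ>\<^sub>J y)" for x y
    using D.form_vanishes[of x y] by (simp add: D_def)
  moreover have "linear_on_submodule matrix_square smul T"
    using homT by (simp add: linear_on_submodule_def module_hom.add module_hom.scale)
  ultimately show "\<exists>T. linear_on_submodule matrix_square smul T \<and> (\<forall>x y. B x y = T (x \<circ>\<^sub>J y))"
    by blast
\<comment> \<open>Conversely, given \<open>T\<close>, the constant is
  \<open>w = T (matrix_unit s s)\<close>.\<close>
qed metis

end
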